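(* Let $r,s,k$ be positive integers such that $r<s$, $\gcd(r,s)=1$, and $r+s$ divides $k$. Let $t\in\{0,1,\ldots,r+s-1\}$ be the unique integer with $\frac{sk}{r+s}-1+t\equiv0\pmod{r+s}$ and $t'\in\{0,1,\ldots,r+s-1\}$ the unique integer with $\frac{rk}{r+s}-1+t'\equiv 0\pmod{r+s}$. Suppose $n\ge k$, $$n\ge\begin{cases}\left(\frac{rsk}{(r+s)^2}-\frac{r+st}{r+s}\right)k+\frac{sk}{r+s}+t & t\le r,\\ \left(\frac{rsk}{(r+s)^2}-\frac{r+r(r+s-t)}{r+s}\right)k+\frac{sk}{r+s}-(r+s-t) & t>r,\end{cases}$$ and $$n\ge\begin{cases}\left(\frac{rsk}{(r+s)^2}-\frac{s+rt'}{r+s}\right)k+\frac{rk}{r+s}+t' & t'\le s,\\ \left(\frac{rsk}{(r+s)^2}-\frac{s+s(r+s-t')}{r+s}\right)k+\frac{rk}{r+s}-(r+s-t') & t'>s.\end{cases}$$ Then every function $f:[n]\to\{-r,s\}$ with $f([n])=0$ has a $k$-block $B\subseteq[n]$ with $f(B)=0$.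
   Context: $[n]=\{1,\ldots,n\}$; for $Y\subseteq[n]$, $f(Y)=\sum_{y\in Y}f(y)$. A $k$-block is a set of $k$ consecutive integers. *)

theory Defs
  imports Complex_Main "HOL-Number_Theory.Cong"
begin

(* For k > 0 the interval below has exactly k elements. *)
definition is_block :: "int \<Rightarrow> int set \<Rightarrow> bool" where
  "is_block k B \<longleftrightarrow> (\<exists>a. B = {a..a + k - 1})"

end

theory Submission
  imports Defs
begin

text \<open>
  Put \<open>w = r + s\<close>. All \<open>k\<close>-block sums are multiples of \<open>w\<close>, and sliding a block by one changes its
  sum by at most \<open>w\<close>; so if no block sum vanishes, they all have the same sign, say positive (else
  replace \<open>f\<close> by \<open>-f\<close> and swap \<open>r\<close> and \<open>s\<close>), hence are at least \<open>w\<close>. Cut \<open>[n]\<close> into \<open>q\<close> blocks and a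
  remainder of length \<open>m = w j\<close>. The remainder has sum at least \<open>-r m\<close>, and, since it is a final
  segment of the last block, at least \<open>w - s (k - m)\<close>. Thus \<open>q w \<le> r m\<close> and
  \<open>q w + w \<le> s (k - m)\<close>, and maximising \<open>n = q k + m\<close> under these constraints contradicts the
  assumed lower bound on \<open>n\<close>.
\<close>

section \<open>Divisibility and sign of block sums\<close>

lemma dvd_sum_two_valued:
  fixes f :: "'a \<Rightarrow> int"
  assumes "f ` S \<subseteq> {- r, s}"
  shows "(r + s) dvd sum f S - int (card S) * s"
proof -
  \<comment> \<open>Both values \<open>- r\<close> and \<open>s\<close> are congruent to
    \<open>s\<close> modulo \<open>r + s\<close>.\<close>
  have "(r + s) dvd f x - s" if "x \<in> S" for x
  proof -
    have "f x = - r \<or> f x = s" using assms that by blast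
    moreover have "- r - s = - (r + s)" by simp
    ultimately show ?thesis by (metis cancel_comm_monoid_add_class.diff_cancel dvd_0_right dvd_minus_iff dvd_refl)
  qed
  then have "(r + s) dvd (\<Sum>x\<in>S. f x - s)" by (rule dvd_sum)
  then show ?thesis by (simp add: sum_subtractf)
qed

lemma sum_atLeastAtMost_int_split:
  fixes f :: "int \<Rightarrow> int"
  assumes "a \<le> b + 1" "b \<le> c"
  shows "sum f {a..c} = sum f {a..b} + sum f {b + 1..c}"
proof -
  have "{a..c} = {a..b} \<union> {b + 1..c}" using assms by auto
  then show ?thesis by (simp add: sum.union_disjoint)
qed

lemma block_sum_Suc:
  fixes f :: "int \<Rightarrow> int"
  assumes "k > 0"
  shows "sum f {a + 1..a + 1 + k - 1} = sum f {a..a + k - 1} + f (a + k) - f a"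
  using sum_atLeastAtMost_int_split[of a "a" "a + k" f]
    sum_atLeastAtMost_int_split[of a "a + k - 1" "a + k" f] assms by (simp add: algebra_simps)

text \<open>Induction on the start \<open>a\<close>: a positive block sum is at least
  \<open>r + s\<close> by divisibility, so one slide leaves it nonnegative, and \<open>nz\<close>
  excludes zero.\<close>

lemma block_sums_ge:
  fixes f :: "int \<Rightarrow> int"
  assumes "r > 0" "s > 0" "k > 0" "(r + s) dvd k"
    and f: "f ` {1..n} \<subseteq> {- r, s}"
    and nz: "\<And>a. 1 \<le> a \<Longrightarrow> a + k - 1 \<le> n \<Longrightarrow> sum f {a..a + k - 1} \<noteq> 0"
    and first: "sum f {1..k} > 0"
    and "1 \<le> a" "a + k - 1 \<le> n"
  shows "sum f {a..a + k - 1} \<ge> r + s"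
proof -
  have dvd: "(r + s) dvd sum f {a..a + k - 1}" if "1 \<le> a" "a + k - 1 \<le> n" for a
  proof -
    have "f ` {a..a + k - 1} \<subseteq> {- r, s}"
      using f that by (meson atLeastatMost_subset_iff dual_order.trans image_mono)
    from dvd_sum_two_valued[OF this] have "(r + s) dvd sum f {a..a + k - 1} - k * s"
      using \<open>k > 0\<close> by simp
    moreover have "(r + s) dvd k * s" using \<open>(r + s) dvd k\<close> by simp
    ultimately show ?thesis by (simp add: dvd_diff_left_iff)
  qed
  have pos: "a + k - 1 \<le> n \<longrightarrow> sum f {a..a + k - 1} > 0"
    using \<open>1 \<le> a\<close>
  proof (induction a rule: int_ge_induct)
    case base
    then show ?case using first by simp
  next
    case (step a)
    show ?case
    proof
      assume le: "a + 1 + k - 1 \<le> n"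
      have "sum f {a..a + k - 1} \<ge> r + s"
        using zdvd_imp_le[OF dvd[of a]] step le by simp
      moreover have "f a \<in> {- r, s}" "f (a + k) \<in> {- r, s}"
        using f step.hyps le \<open>k > 0\<close> by (auto simp: image_subset_iff)
      ultimately have "sum f {a + 1..a + 1 + k - 1} \<ge> 0"
        using block_sum_Suc[OF \<open>k > 0\<close>, of f a] \<open>r > 0\<close> \<open>s > 0\<close> by auto
      moreover have "sum f {a + 1..a + 1 + k - 1} \<noteq> 0"
        using nz[of "a + 1"] step.hyps le by simp
      ultimately show "sum f {a + 1..a + 1 + k - 1} > 0" by linarith
    qed
  qed
  then show ?thesis
    using zdvd_imp_le[OF dvd[of a]] assms by simp
qed

section \<open>Quotient and remainder of \<open>n\<close> by \<open>k\<close>, and the resulting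
  bound on \<open>n\<close>\<close>

lemma sum_consecutive_blocks_ge:
  fixes f :: "int \<Rightarrow> int"
  assumes "k > 0"
    and "\<And>a. 1 \<le> a \<Longrightarrow> a + k - 1 \<le> int q * k \<Longrightarrow> sum f {a..a + k - 1} \<ge> w"
  shows "sum f {1..int q * k} \<ge> int q * w"
  using assms(2)
proof (induction q)
  case 0
  then show ?case by simp
next
  case (Suc q)
  have "sum f {1..int q * k} \<ge> int q * w"
    using Suc.prems \<open>k > 0\<close> by (intro Suc.IH) (simp add: algebra_simps)
  moreover have "sum f {int q * k + 1..int q * k + 1 + k - 1} \<ge> w"
    using Suc.prems[of "int q * k + 1"] \<open>k > 0\<close> by (simp add: algebra_simps)
  ultimately show ?case
    using sum_atLeastAtMost_int_split[of 1 "int q * k" "int (Suc q) * k" f] \<open>k > 0\<close>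
    by (simp add: algebra_simps)
qed

text \<open>As the total is zero, the last \<open>n mod k\<close> entries cancel the sum of the
  \<open>n div k\<close> blocks before them, which is at least \<open>(n div k) * (r + s)\<close>.
  Two estimates limit how negative this remainder can be.\<close>

lemma quotient_remainder_bounds:
  fixes f :: "int \<Rightarrow> int"
  assumes "r > 0" "s > 0" "k > 0" "(r + s) dvd k" "n \<ge> k"
    and f: "f ` {1..n} \<subseteq> {- r, s}" and zero: "sum f {1..n} = 0"
    and nz: "\<And>a. 1 \<le> a \<Longrightarrow> a + k - 1 \<le> n \<Longrightarrow> sum f {a..a + k - 1} \<noteq> 0"
    and first: "sum f {1..k} > 0"
  shows "(n div k) * (r + s) \<le> r * (n mod k)"
    and "(n div k) * (r + s) + (r + s) \<le> s * (k - n mod k)"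
proof -
  define q m where "q = n div k" and "m = n mod k"
  have n: "n = q * k + m" and m: "0 \<le> m" "m < k" and "q \<ge> 0"
    using assms by (auto simp: q_def m_def pos_imp_zdiv_nonneg_iff)
  note ge = block_sums_ge[OF assms(1-4) f nz first]
  have "sum f {1..int (nat q) * k} \<ge> int (nat q) * (r + s)"
    by (rule sum_consecutive_blocks_ge[OF \<open>k > 0\<close> ge]) (use n m \<open>q \<ge> 0\<close> in auto)
  then have blocks: "sum f {1..q * k} \<ge> q * (r + s)" using \<open>q \<ge> 0\<close> by simp
  have "0 \<le> q * k" using \<open>q \<ge> 0\<close> \<open>k > 0\<close> by simp
  then have rest: "sum f {q * k + 1..n} = - sum f {1..q * k}"
    using sum_atLeastAtMost_int_split[of 1 "q * k" n f] zero n m by simp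
  have lower: "f x \<ge> - r" and upper: "f x \<le> s" if "x \<in> {1..n}" for x
  proof -
    have "f x = - r \<or> f x = s" using f that by blast
    then show "f x \<ge> - r" "f x \<le> s" using \<open>r > 0\<close> \<open>s > 0\<close> by auto
  qed
  \<comment> \<open>First estimate: each of the \<open>m\<close> entries of the remainder is at
    least \<open>- r\<close>.\<close>
  have "(\<Sum>x\<in>{q * k + 1..n}. - r) \<le> sum f {q * k + 1..n}"
    using \<open>0 \<le> q * k\<close> by (intro sum_mono lower) auto
  then have "sum f {q * k + 1..n} \<ge> - (r * m)" using n m by (simp add: algebra_simps)
  then show "(n div k) * (r + s) \<le> r * (n mod k)"
    using blocks rest unfolding q_def m_def by linarith
  \<comment> \<open>Second estimate: in the last block, the \<open>k - m\<close> entries before the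
    remainder must offset its deficit and still leave \<open>r + s\<close>.\<close>
  have "sum f {n - k + 1..q * k} \<le> (\<Sum>x\<in>{n - k + 1..q * k}. s)"
    using n m \<open>n \<ge> k\<close> by (intro sum_mono upper) auto
  then have "sum f {n - k + 1..q * k} \<le> s * (k - m)"
    using n m by (simp add: algebra_simps)
  moreover have "sum f {n - k + 1..n} \<ge> r + s" using ge[of "n - k + 1"] \<open>n \<ge> k\<close> by simp
  moreover have "sum f {n - k + 1..n} = sum f {n - k + 1..q * k} + sum f {q * k + 1..n}"
    using n m by (intro sum_atLeastAtMost_int_split) auto
  ultimately show "(n div k) * (r + s) + (r + s) \<le> s * (k - n mod k)"
    using blocks rest unfolding q_def m_def by linarith
qed

text \<open>With \<open>n mod k = w * j\<close>, one bound on \<open>q\<close> increases in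
  \<open>j\<close> and the other decreases; they cross between \<open>e - 1\<close> and
  \<open>e\<close>. Since \<open>w * j < k\<close>, the size of \<open>q\<close> matters first: the
  best choice is \<open>j = e\<close> with \<open>q = r * e - t\<close> if \<open>t \<le> r\<close>,
  and otherwise \<open>j = e - 1\<close> with \<open>q = r * (e - 1)\<close>.\<close>

lemma length_bound_if_all_blocks_positive:
  fixes f :: "int \<Rightarrow> int"
  assumes "r > 0" "s > 0" "k > 0" "coprime r s" "n \<ge> k"
    and k: "k = (r + s) * c" and e: "s * c - 1 + t = (r + s) * e" and "0 \<le> t"
    and f: "f ` {1..n} \<subseteq> {- r, s}" and zero: "sum f {1..n} = 0"
    and nz: "\<And>a. 1 \<le> a \<Longrightarrow> a + k - 1 \<le> n \<Longrightarrow> sum f {a..a + k - 1} \<noteq> 0"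
    and first: "sum f {1..k} > 0"
  shows "n \<le> (if t \<le> r then (r * e - t) * k + (r + s) * e
               else r * (e - 1) * k + (r + s) * (e - 1))"
proof -
  define w q where "w = r + s" and "q = n div k"
  have "w > 0" using assms by (simp add: w_def)
  have "c > 0" using \<open>k > 0\<close> k \<open>w > 0\<close> by (simp add: w_def zero_less_mult_iff)
  \<comment> \<open>The sum over \<open>{1..n}\<close> is zero and congruent to \<open>n * s\<close>
    modulo \<open>w\<close>; coprimality then makes \<open>n\<close>, and hence the remainder, a
    multiple of \<open>w\<close>.\<close>
  have "w dvd n * s"
    using dvd_sum_two_valued[OF f] zero \<open>n \<ge> k\<close> \<open>k > 0\<close> by (simp add: w_def)
  moreover have "coprime w s" using \<open>coprime r s\<close> by (simp add: w_def coprime_iff_gcd_eq_1)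
  ultimately have "w dvd n" using coprime_dvd_mult_left_iff by blast
  then have "w dvd n mod k" using k by (simp add: w_def dvd_mod)
  then obtain j where j: "n mod k = w * j" by blast
  have n: "n = q * k + w * j" using j by (metis q_def div_mult_mod_eq)
  have "w * j < w * c" using j k \<open>k > 0\<close> by (metis pos_mod_bound w_def)
  then have "j < c" using \<open>w > 0\<close> by simp
  have "w * e \<ge> 0" using e \<open>s > 0\<close> \<open>c > 0\<close> \<open>0 \<le> t\<close> unfolding w_def
    by (metis add_nonneg_nonneg int_one_le_iff_zero_less le_diff_eq add_0 mult_pos_pos)
  then have "e \<ge> 0" using \<open>w > 0\<close> by (simp add: zero_le_mult_iff)
  have "(r + s) dvd k" using k by simp
  note bounds = quotient_remainder_bounds[OF assms(1-3) this \<open>n \<ge> k\<close> f zero nz first,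
      folded q_def w_def, unfolded j]
  have "w * q \<le> w * (r * j)" using bounds(1) by (simp add: algebra_simps)
  then have q1: "q \<le> r * j" using \<open>w > 0\<close> by simp
  have "w * (q + 1) \<le> w * (s * (c - j))" using bounds(2) k by (simp add: algebra_simps w_def)
  then have "q + 1 \<le> s * (c - j)" using \<open>w > 0\<close> by (simp only: mult_le_cancel_left_pos)
  \<comment> \<open>Substitute \<open>s * c = w * e + 1 - t\<close> to centre the decreasing bound
    at \<open>j = e\<close>.\<close>
  then have q2: "q \<le> r * e - t - s * (j - e)" using e by (simp add: algebra_simps)
  have wj: "w * j \<le> k" using k \<open>w * j < w * c\<close> by (simp add: w_def)
  show ?thesis
  proof (cases "j \<le> e - 1")
    case True
    have "r * j \<le> r * (e - 1)" using True \<open>r > 0\<close> by simp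
    with q1 have q: "q \<le> r * (e - 1)" by linarith
    then have le: "q * k \<le> r * (e - 1) * k" using \<open>k > 0\<close> by simp
    have we: "w * j \<le> w * (e - 1)" using True \<open>w > 0\<close> by simp
    show ?thesis
    proof (cases "t \<le> r")
      case t: True
      have "q \<le> r * e - t" using q t by (simp add: algebra_simps)
      then have "q * k \<le> (r * e - t) * k" using \<open>k > 0\<close> by simp
      moreover have "w * (e - 1) \<le> w * e" using \<open>w > 0\<close> by simp
      ultimately show ?thesis using n we t by (simp add: w_def)
    next
      case False
      then show ?thesis using n we le by (simp add: w_def)
    qed
  next
    case False
    then have "s * (j - e) \<ge> 0" using \<open>s > 0\<close> by simp
    then have q: "q \<le> r * e - t" using q2 by linarith
    show ?thesis
    proof (cases "t \<le> r")
      case t: True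
      show ?thesis
      proof (cases "j = e")
        case True
        have "q * k \<le> (r * e - t) * k" using q \<open>k > 0\<close> by simp
        then show ?thesis using n t True by (simp add: w_def)
      next
        case ne: False
        \<comment> \<open>Here \<open>j > e\<close>: at least one block is lost, which outweighs any
          remainder because \<open>w * j \<le> k\<close>.\<close>
        then have "s * (j - e) > 0" using False \<open>s > 0\<close> by simp
        then have "q + 1 \<le> r * e - t" using q2 by linarith
        then have "(q + 1) * k \<le> (r * e - t) * k" using \<open>k > 0\<close> by simp
        then have "n \<le> (r * e - t) * k" using n wj by (simp add: distrib_right)
        then show ?thesis using t \<open>w * e \<ge> 0\<close> by (simp add: w_def)
      qed
    next
      case t: False
      \<comment> \<open>From \<open>t > r\<close>, \<open>r * e - t\<close> is below
        \<open>r * (e - 1)\<close>, so again a whole block is lost.\<close>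
      have "q + 1 \<le> r * (e - 1)" using q t by (simp add: algebra_simps)
      then have "(q + 1) * k \<le> r * (e - 1) * k" using \<open>k > 0\<close> by simp
      then have "n \<le> r * (e - 1) * k" using n wj by (simp add: distrib_right)
      \<comment> \<open>This gives \<open>e \<ge> 1\<close>, so that the term
        \<open>w * (e - 1)\<close> of the claimed bound is nonnegative.\<close>
      moreover have "w * e > 0"
      proof -
        have "s * c > 0" using \<open>s > 0\<close> \<open>c > 0\<close> by simp
        then show ?thesis using e t \<open>r > 0\<close> by (simp add: w_def)
      qed
      then have "w * (e - 1) \<ge> 0" using \<open>w > 0\<close> by (simp add: zero_less_mult_iff)
      ultimately show ?thesis using t by (simp add: w_def)
    qed
  qed
qed

section \<open>The stated threshold and the conclusion\<close>

lemma zero_sum_blockI: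
  assumes "1 \<le> a" "a + k - 1 \<le> n" "(\<Sum>y\<in>{a..a + k - 1}. f y) = (0::int)"
  shows "\<exists>B. is_block k B \<and> B \<subseteq> {1..n} \<and> (\<Sum>y\<in>B. f y) = 0"
  using assms unfolding is_block_def by (intro exI[of _ "{a..a + k - 1}"]) auto

text \<open>Inserting \<open>s * c = (r + s) * e + 1 - t\<close> turns the rational coefficients of
  \<open>k\<close> into integers. The final \<open>+ 1\<close> is what makes the assumed lower bound
  on \<open>n\<close> exceed the upper bound of
  \<open>length_bound_if_all_blocks_positive\<close>.\<close>

lemma threshold_eq:
  fixes r s k c t e :: int
  assumes "r > 0" "s > 0" and k: "k = (r + s) * c" and e: "s * c - 1 + t = (r + s) * e"
  shows "(if t \<le> r
       then (real_of_int (r * s * k) / real_of_int ((r + s)^2)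
              - real_of_int (r + s * t) / real_of_int (r + s)) * real_of_int k
            + real_of_int (s * k) / real_of_int (r + s) + real_of_int t
       else (real_of_int (r * s * k) / real_of_int ((r + s)^2)
              - real_of_int (r + r * (r + s - t)) / real_of_int (r + s)) * real_of_int k
            + real_of_int (s * k) / real_of_int (r + s) - real_of_int (r + s - t))
    = real_of_int ((if t \<le> r then (r * e - t) * k + (r + s) * e
               else r * (e - 1) * k + (r + s) * (e - 1)) + 1)"
proof -
  define w where "w = r + s"
  have w: "real_of_int w \<noteq> 0" using assms by (simp add: w_def)
  have sk: "real_of_int (s * k) / real_of_int w = of_int (s * c)"
    using w k by (simp add: w_def[symmetric])
  have rsk: "real_of_int (r * s * k) / real_of_int (w^2) = real_of_int (r * (s * c)) / real_of_int w"
    using w k by (simp add: w_def[symmetric] power2_eq_square)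
  have sc: "s * c = w * e + 1 - t" using e by (simp add: w_def)
  have "r * (s * c) - (r + s * t) = w * (r * e - t)"
    unfolding sc by (simp add: w_def algebra_simps)
  then have 1: "real_of_int (r * (s * c)) / real_of_int w - real_of_int (r + s * t) / real_of_int w
      = of_int (r * e - t)"
    using w by (metis diff_divide_distrib nonzero_mult_div_cancel_left of_int_diff of_int_mult)
  have "r * (s * c) - (r + r * (w - t)) = w * (r * (e - 1))"
    unfolding sc by (simp add: w_def algebra_simps)
  then have 2: "real_of_int (r * (s * c)) / real_of_int w - real_of_int (r + r * (w - t)) / real_of_int w
      = of_int (r * (e - 1))"
    using w by (metis diff_divide_distrib nonzero_mult_div_cancel_left of_int_diff of_int_mult)
  show ?thesis
    unfolding w_def[symmetric] rsk sk 1 2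
    unfolding sc by (simp add: algebra_simps)
qed

theorem theorem2p14:
  fixes r s k n t t' :: int and f :: "int \<Rightarrow> int"
  assumes "r > 0" and "s > 0" and "k > 0"
    and "r < s" and "gcd r s = 1" and "(r + s) dvd k"
    and "t \<in> {0..r + s - 1}" and "[s * k div (r + s) - 1 + t = 0] (mod (r + s))"
    and "t' \<in> {0..r + s - 1}" and "[r * k div (r + s) - 1 + t' = 0] (mod (r + s))"
    and "n \<ge> k"
    and "real_of_int n \<ge>
      (if t \<le> r
       then (real_of_int (r * s * k) / real_of_int ((r + s)^2)
              - real_of_int (r + s * t) / real_of_int (r + s)) * real_of_int k
            + real_of_int (s * k) / real_of_int (r + s) + real_of_int t
       else (real_of_int (r * s * k) / real_of_int ((r + s)^2)
              - real_of_int (r + r * (r + s - t)) / real_of_int (r + s)) * real_of_int k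
            + real_of_int (s * k) / real_of_int (r + s) - real_of_int (r + s - t))"
    and "real_of_int n \<ge>
      (if t' \<le> s
       then (real_of_int (r * s * k) / real_of_int ((r + s)^2)
              - real_of_int (s + r * t') / real_of_int (r + s)) * real_of_int k
            + real_of_int (r * k) / real_of_int (r + s) + real_of_int t'
       else (real_of_int (r * s * k) / real_of_int ((r + s)^2)
              - real_of_int (s + s * (r + s - t')) / real_of_int (r + s)) * real_of_int k
            + real_of_int (r * k) / real_of_int (r + s) - real_of_int (r + s - t'))"
    and "f ` {1..n} \<subseteq> {- r, s}"
    and "(\<Sum>y\<in>{1..n}. f y) = 0"
  shows "\<exists>B. is_block k B \<and> B \<subseteq> {1..n} \<and> (\<Sum>y\<in>B. f y) = 0"
proof (rule ccontr)
  assume no: "\<not> ?thesis"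
  then have nz: "sum f {a..a + k - 1} \<noteq> 0" if "1 \<le> a" "a + k - 1 \<le> n" for a
    using zero_sum_blockI that by blast
  have cop: "coprime r s" using \<open>gcd r s = 1\<close> by (simp add: coprime_iff_gcd_eq_1)
  obtain c where k: "k = (r + s) * c" using \<open>(r + s) dvd k\<close> by blast
  have "r + s \<noteq> 0" using \<open>r > 0\<close> \<open>s > 0\<close> by simp
  have "s * k div (r + s) = s * c" "r * k div (r + s) = r * c"
    using \<open>r + s \<noteq> 0\<close> k by (metis mult.left_commute nonzero_mult_div_cancel_left)+
  then obtain e e' where e: "s * c - 1 + t = (r + s) * e" and e': "r * c - 1 + t' = (r + s) * e'"
    using assms(8,10) unfolding cong_0_iff dvd_def by metis
  show False
  proof (cases "sum f {1..k} > 0")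
    case True
    show False
      using length_bound_if_all_blocks_positive[OF assms(1-3) cop assms(11) k e _ assms(14,15) nz True]
        assms(7,12)[unfolded threshold_eq[OF assms(1,2) k e]] by simp
  next
    case False
    moreover have "sum f {1..k} \<noteq> 0" using nz[of 1] \<open>n \<ge> k\<close> by simp
    \<comment> \<open>The negated function takes values in \<open>{- s, r}\<close>, so the same
      bound applies with \<open>r\<close> and \<open>s\<close> exchanged and \<open>t'\<close>,
      \<open>e'\<close> in place of \<open>t\<close>, \<open>e\<close>.\<close>
    ultimately have first: "sum (\<lambda>x. - f x) {1..k} > 0" by (simp add: sum_negf)
    have k': "k = (s + r) * c" and e'': "r * c - 1 + t' = (s + r) * e'"
      using k e' by (simp_all add: add.commute)
    have "coprime s r" using cop by (simp add: coprime_commute)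
    note bound = length_bound_if_all_blocks_positive[OF assms(2,1,3) this assms(11) k' e'',
        of "\<lambda>x. - f x"]
    have "- f x \<in> {- s, r}" if "x \<in> {1..n}" for x
    proof -
      have "f x = - r \<or> f x = s" using assms(14) that by blast
      then show ?thesis by auto
    qed
    then have range: "(\<lambda>x. - f x) ` {1..n} \<subseteq> {- s, r}" by blast
    \<comment> \<open>These equations bring the exchanged threshold into the form of the second
      assumption on \<open>n\<close>.\<close>
    have eqs: "s * r * k = r * s * k" "s + r = r + s" by simp_all
    show False
      using bound[OF _ range _ _ first] assms(9,15) nz
        assms(13)[unfolded threshold_eq[OF assms(2,1) k' e'', unfolded eqs]]
      unfolding eqs by (simp add: sum_negf)
  qed
qed
end
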